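(* For every complex number $s$ with $\Re(s) > 1$, $$\zeta(s) = \sum_{j,k=1}^{\infty}\left(\frac{1}{(\max(j,k))^{s+1}} - \frac{1}{(j+k)^{s+1}}\right).$$
   Context: $\zeta$ denotes the Riemann zeta function, $\zeta(s) = \sum_{m=1}^{\infty} m^{-s}$ for $\Re(s)>1$. The double sum runs over all ordered pairs $(j,k)$ of positive integers. *)

theory Defs
  imports "HOL-Analysis.Analysis"
begin

text \<open>The Riemann zeta function on the half-plane \<open>Re s > 1\<close>, where its Dirichlet series converges;
  no analytic continuation is intended, so values for \<open>Re s \<le> 1\<close> carry no meaning.\<close>

definition riemann_zeta :: "complex \<Rightarrow> complex" where
  "riemann_zeta s = (\<Sum>m. of_nat (Suc m) powr (- s))"

end

theory Submission
  imports Defs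
begin

text \<open>
  The two parts of the summand converge absolutely on their own, so they may be summed separately,
  each along the level sets of the function of \<open>(j, k)\<close> on which it depends
  (lemma \<open>has_sum_fibres\<close>). The level \<open>max j k = n\<close> consists of \<open>2 * n - 1\<close> pairs and the level
  \<open>j + k = n\<close> of \<open>n - 1\<close> pairs. Since \<open>n / n powr (s + 1) = n powr (- s)\<close>, the two sums are
  \<open>2 * \<zeta>(s) - \<zeta>(s + 1)\<close> and \<open>\<zeta>(s) - \<zeta>(s + 1)\<close>, and their difference is \<open>\<zeta>(s)\<close>.
\<close>

text \<open>
  For complex series unconditional and absolute convergence agree. Hence convergence of the grouped
  series, whose terms are constant along each fibre, already bounds the norms of the ungrouped one.
\<close>

lemma has_sum_fibres:
  fixes f :: "'b \<Rightarrow> complex" and g :: "'a \<Rightarrow> 'b"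
  assumes maps: "g ` A \<subseteq> B"
    and fin: "\<And>b. b \<in> B \<Longrightarrow> finite {a \<in> A. g a = b}"
    and sum: "((\<lambda>b. of_nat (card {a \<in> A. g a = b}) * f b) has_sum S) B"
  shows "((\<lambda>a. f (g a)) has_sum S) A"
proof -
  define F where "F b = {a \<in> A. g a = b}" for b
  have "(\<lambda>b. norm (of_nat (card (F b)) * f b)) summable_on B"
    using sum unfolding F_def
    by (intro summable_on_iff_abs_summable_on_complex[THEN iffD1] has_sum_imp_summable)
  also have "?this \<longleftrightarrow> (\<lambda>b. norm (\<Sum>\<^sub>\<infinity>a\<in>F b. norm (f b))) summable_on B"
    by (intro summable_on_cong) (use fin in \<open>auto simp: F_def norm_mult\<close>)
  finally have "(\<lambda>x. norm (case x of (b, a) \<Rightarrow> f b)) summable_on Sigma B F"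
    using fin by (auto simp: Infinite_Sum.abs_summable_on_Sigma_iff F_def case_prod_unfold)
  then have summable: "(\<lambda>(b, a). f b) summable_on Sigma B F"
    by (rule abs_summable_summable)
  have "((\<lambda>(b, a). f b) has_sum S) (Sigma B F)"
  proof (rule has_sum_SigmaI)
    show "((\<lambda>a. case (b, a) of (b, a) \<Rightarrow> f b) has_sum of_nat (card (F b)) * f b) (F b)"
      if "b \<in> B" for b
      using fin[OF that] by (auto simp: F_def intro: has_sum_finiteI)
  qed (use sum summable in \<open>auto simp: F_def\<close>)
  moreover have "((\<lambda>(b, a). f b) has_sum S) (Sigma B F) \<longleftrightarrow> ((\<lambda>a. f (g a)) has_sum S) A"
    by (rule has_sum_reindex_bij_witness[of _ "\<lambda>a. (g a, a)" snd])
      (use maps in \<open>auto simp: F_def\<close>)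
  ultimately show ?thesis by simp
qed

lemma has_sum_diff:
  fixes f g :: "'a \<Rightarrow> 'b::topological_ab_group_add"
  assumes "(f has_sum a) A" and "(g has_sum b) A"
  shows "((\<lambda>x. f x - g x) has_sum (a - b)) A"
  using has_sum_add[OF assms(1), of "\<lambda>x. - g x" "- b"] assms(2) by (simp add: has_sum_uminus)

lemma has_sum_riemann_zeta:
  fixes s :: complex
  assumes "Re s > 1"
  shows "((\<lambda>n. 1 / of_nat n powr s) has_sum riemann_zeta s) {1::nat..}"
proof -
  have norm_term: "norm (of_nat n powr (- s) :: complex) = real n powr (- Re s)" for n :: nat
    using norm_powr_real_powr[of "of_nat n" "- s"] by simp
  have "summable (\<lambda>n. real n powr (- Re s))"
    using assms by (simp add: summable_real_powr_iff)
  then have norm_summable: "summable (\<lambda>n. norm (of_nat (Suc n) powr (- s) :: complex))"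
    unfolding norm_term by (rule summable_Suc_iff[THEN iffD2])
  have "((\<lambda>n. of_nat (Suc n) powr (- s)) has_sum riemann_zeta s) UNIV"
    unfolding riemann_zeta_def
    by (rule norm_summable_imp_has_sum[OF norm_summable
          summable_sums[OF summable_norm_cancel[OF norm_summable]]])
  moreover have "((\<lambda>n. of_nat (Suc n) powr (- s)) has_sum riemann_zeta s) UNIV \<longleftrightarrow>
      ((\<lambda>n. 1 / of_nat n powr s) has_sum riemann_zeta s) {1::nat..}"
    by (rule has_sum_reindex_bij_witness[of _ "\<lambda>n. n - 1" Suc])
      (auto simp: powr_minus_divide)
  ultimately show ?thesis by simp
qed

lemma card_max_fibre:
  assumes "n \<ge> 1"
  shows "card {p \<in> {1::nat..} \<times> {1..}. max (fst p) (snd p) = n} = 2 * n - 1"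
proof -
  obtain m where n: "n = Suc m" using assms by (cases n) auto
  have "{p \<in> {1::nat..} \<times> {1..}. max (fst p) (snd p) = n} = {1..n} \<times> {1..n} - {1..m} \<times> {1..m}"
    unfolding n by (auto simp: max_def split: if_splits)
  also have "card \<dots> = card ({1..n} \<times> {1..n}) - card ({1..m} \<times> {1..m})"
    unfolding n by (intro card_Diff_subset) auto
  also have "\<dots> = 2 * n - 1" by (simp add: n)
  finally show ?thesis .
qed

lemma card_plus_fibre:
  "card {p \<in> {1::nat..} \<times> {1..}. fst p + snd p = n} = n - 1"
proof -
  have "bij_betw (\<lambda>j. (j, n - j)) {1..<n} {p \<in> {1::nat..} \<times> {1..}. fst p + snd p = n}"
    by (rule bij_betw_byWitness[where f' = fst]) auto
  then show ?thesis by (simp add: bij_betw_same_card[symmetric])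
qed

theorem corollary2p3:
  fixes s :: complex
  assumes "Re s > 1"
  shows "((\<lambda>(j::nat, k::nat).
             1 / of_nat (max j k) powr (s + 1) - 1 / of_nat (j + k) powr (s + 1))
           has_sum riemann_zeta s) ({1..} \<times> {1..})"
proof -
  let ?A = "{1::nat..} \<times> {1::nat..}"
  let ?f = "\<lambda>n::nat. 1 / of_nat n powr (s + 1) :: complex"
  have zeta: "((\<lambda>n. 1 / of_nat n powr s) has_sum riemann_zeta s) {1::nat..}"
    using assms by (rule has_sum_riemann_zeta)
  have zeta1: "(?f has_sum riemann_zeta (s + 1)) {1..}"
    using assms by (intro has_sum_riemann_zeta) simp
  have shift: "of_nat n * ?f n = 1 / of_nat n powr s" if "n \<ge> 1" for n
    using that by (simp add: powr_add)
  have "((\<lambda>p. ?f (max (fst p) (snd p))) has_sum (2 * riemann_zeta s - riemann_zeta (s + 1))) ?A"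
  proof (rule has_sum_fibres[where B = "{1..}" and f = ?f and g = "\<lambda>p. max (fst p) (snd p)"])
    show "finite {p \<in> ?A. max (fst p) (snd p) = n}" if "n \<in> {1..}" for n
      by (rule finite_subset[of _ "{..n} \<times> {..n}"]) auto
    have "of_nat (2 * n - 1) * ?f n = 2 * (1 / of_nat n powr s) - ?f n" if "n \<ge> 1" for n
      using that unfolding shift[OF that, symmetric]
      by (simp add: left_diff_distrib diff_divide_distrib)
    then show "((\<lambda>n. of_nat (card {p \<in> ?A. max (fst p) (snd p) = n}) * ?f n) has_sum
        (2 * riemann_zeta s - riemann_zeta (s + 1))) {1..}"
      using has_sum_diff[OF has_sum_cmult_right[OF zeta, of 2] zeta1]
      by (subst has_sum_cong[where g = "\<lambda>n. 2 * (1 / of_nat n powr s) - ?f n"])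
        (simp_all only: card_max_fibre atLeast_iff)
  qed auto
  moreover have "((\<lambda>p. ?f (fst p + snd p)) has_sum (riemann_zeta s - riemann_zeta (s + 1))) ?A"
  proof (rule has_sum_fibres[where B = "{1..}" and f = ?f and g = "\<lambda>p. fst p + snd p"])
    show "finite {p \<in> ?A. fst p + snd p = n}" if "n \<in> {1..}" for n
      by (rule finite_subset[of _ "{..n} \<times> {..n}"]) auto
    have "of_nat (n - 1) * ?f n = 1 / of_nat n powr s - ?f n" if "n \<ge> 1" for n
      using that unfolding shift[OF that, symmetric]
      by (simp add: left_diff_distrib diff_divide_distrib)
    then show "((\<lambda>n. of_nat (card {p \<in> ?A. fst p + snd p = n}) * ?f n) has_sum
        (riemann_zeta s - riemann_zeta (s + 1))) {1..}"
      using has_sum_diff[OF zeta zeta1]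
      by (subst has_sum_cong[where g = "\<lambda>n. 1 / of_nat n powr s - ?f n"])
        (simp_all only: card_plus_fibre atLeast_iff)
  qed auto
  ultimately have "((\<lambda>p. ?f (max (fst p) (snd p)) - ?f (fst p + snd p)) has_sum
      (2 * riemann_zeta s - riemann_zeta (s + 1) - (riemann_zeta s - riemann_zeta (s + 1)))) ?A"
    by (rule has_sum_diff)
  then show ?thesis by (simp add: case_prod_unfold)
qed

end
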